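(* Let $(A, [\,, ], P_{\Omega},p)$ be a matching Hom-Lie Rota-Baxter algebra of weight zero (i.e. $\lambda_{\omega}=0$ for all $\omega \in \Omega$). Assume that $p \circ P_{\omega}=P_{\omega} \circ p$ for each $\omega \in \Omega$. Then $(A, \{\ast_{\omega} \mid \omega \in \Omega \}, p)$ is a matching Hom-preLie algebra, where $$x \ast_{\omega} y := [P_{\omega}(x), y] \quad \text{for } x,y \in A \text{ and } \omega \in \Omega.$$
   Context: Let $\mathbf{k}$ be a unitary commutative ring, the base ring of all modules and linear maps, and let $\Omega$ be a nonempty set. A Hom-Lie algebra is a triple $(A,[\,,],p)$ consisting of a $\mathbf{k}$-module $A$, a bilinear bracket $[\,,]:A\otimes A\to A$ with $[x,x]=0$ for all $x$ (hence skew-symmetric), and a linear map $p:A\to A$ satisfying $[p(x),[y,z]]+[p(y),[z,x]]+[p(z),[x,y]]=0$ for all $x,y,z\in A$. For a family $\lambda_{\Omega}=(\lambda_{\omega})_{\omega \in \Omega}$ of scalars in $\mathbf{k}$, a matching Hom-Lie Rota-Baxter algebra $(A,[\,,],P_\Omega,p)$ of weight $\lambda_\Omega$ is a Hom-Lie algebra $(A, [\,,],p)$ endowed with a family $P_\Omega=(P_\omega)_{\omega\in\Omega}$ of linear maps $P_{\omega} : A \rightarrow A$ such that $$[P_{\alpha}(x),P_{\beta}(y)] = P_{\alpha}([x, P_{\beta}(y)]) + P_{\beta}([P_{\alpha}(x), y])+ \lambda_{\beta} P_{\alpha}([x,y])\quad\text{for all } x,y\in A,\ \alpha,\beta\in\Omega.$$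 A matching Hom-preLie algebra is a $\mathbf{k}$-module $A$ with bilinear operations $\ast_{\omega}: A \otimes A \rightarrow A$ ($\omega \in \Omega$) and a linear map $p: A \rightarrow A$ such that for all $x,y,z\in A$, $\alpha,\beta\in\Omega$: $$p(x) \ast_{\alpha} (y \ast_{\beta} z)-(x \ast_{\alpha} y) \ast_{\beta} p(z)=p(y) \ast_{\beta}(x \ast_{\alpha} z)-(y \ast_{\beta} x)\ast_{\alpha} p(z).$$ *)

theory Defs
  imports "HOL-Algebra.Module"
begin

definition linear_endo ::
    "('k, 'r) ring_scheme \<Rightarrow> ('k, 'a, 'm) module_scheme \<Rightarrow> ('a \<Rightarrow> 'a) \<Rightarrow> bool" where
  "linear_endo R A f \<longleftrightarrow>
     f \<in> carrier A \<rightarrow> carrier A \<and>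
     (\<forall>x\<in>carrier A. \<forall>y\<in>carrier A. f (x \<oplus>\<^bsub>A\<^esub> y) = f x \<oplus>\<^bsub>A\<^esub> f y) \<and>
     (\<forall>c\<in>carrier R. \<forall>x\<in>carrier A. f (c \<odot>\<^bsub>A\<^esub> x) = c \<odot>\<^bsub>A\<^esub> f x)"

text \<open>Linear maps \<open>A \<otimes> A \<rightarrow> A\<close> are rendered as bilinear operations on \<open>A\<close>.\<close>

definition bilinear_op ::
    "('k, 'r) ring_scheme \<Rightarrow> ('k, 'a, 'm) module_scheme \<Rightarrow> ('a \<Rightarrow> 'a \<Rightarrow> 'a) \<Rightarrow> bool" where
  "bilinear_op R A g \<longleftrightarrow>
     (\<forall>x\<in>carrier A. linear_endo R A (\<lambda>y. g x y)) \<and>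
     (\<forall>y\<in>carrier A. linear_endo R A (\<lambda>x. g x y))"

text \<open>
  The locale \<^locale>\<open>module\<close> includes that \<open>R\<close> is a commutative unital ring (possibly zero). The
  multiplication and unit that the module record formally carries for \<open>A\<close> are unconstrained by it
  and are never used; the bracket is a separate parameter.
\<close>

locale hom_lie_algebra = module R A for R (structure) and A (structure) +
  fixes bracket :: "'b \<Rightarrow> 'b \<Rightarrow> 'b" (\<open>\<lbrakk>_,/ _\<rbrakk>\<close>)
    and p :: "'b \<Rightarrow> 'b"
  assumes bracket_bilinear: "bilinear_op R A bracket"
    and bracket_self: "x \<in> carrier A \<Longrightarrow> \<lbrakk>x, x\<rbrakk> = \<zero>\<^bsub>A\<^esub>"
    and p_linear: "linear_endo R A p"
    and hom_jacobi: "x \<in> carrier A \<Longrightarrow> y \<in> carrier A \<Longrightarrow> z \<in> carrier A \<Longrightarrow>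
      \<lbrakk>p x, \<lbrakk>y, z\<rbrakk>\<rbrakk> \<oplus>\<^bsub>A\<^esub> \<lbrakk>p y, \<lbrakk>z, x\<rbrakk>\<rbrakk> \<oplus>\<^bsub>A\<^esub> \<lbrakk>p z, \<lbrakk>x, y\<rbrakk>\<rbrakk> = \<zero>\<^bsub>A\<^esub>"

locale matching_hom_lie_rota_baxter_algebra = hom_lie_algebra R A bracket p
  for R (structure) and A (structure) and bracket (\<open>\<lbrakk>_,/ _\<rbrakk>\<close>) and p +
  fixes Omega :: "'w set"
    and weight :: "'w \<Rightarrow> 'a"
    and P :: "'w \<Rightarrow> 'b \<Rightarrow> 'b"
  assumes weight_closed: "\<omega> \<in> Omega \<Longrightarrow> weight \<omega> \<in> carrier R"
    and P_linear: "\<omega> \<in> Omega \<Longrightarrow> linear_endo R A (P \<omega>)"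
    and rota_baxter:
      "\<alpha> \<in> Omega \<Longrightarrow> \<beta> \<in> Omega \<Longrightarrow> x \<in> carrier A \<Longrightarrow> y \<in> carrier A \<Longrightarrow>
        \<lbrakk>P \<alpha> x, P \<beta> y\<rbrakk> =
          P \<alpha> \<lbrakk>x, P \<beta> y\<rbrakk> \<oplus>\<^bsub>A\<^esub> P \<beta> \<lbrakk>P \<alpha> x, y\<rbrakk> \<oplus>\<^bsub>A\<^esub> weight \<beta> \<odot>\<^bsub>A\<^esub> P \<alpha> \<lbrakk>x, y\<rbrakk>"

locale matching_hom_prelie_algebra = module R A for R (structure) and A (structure) +
  fixes Omega :: "'w set"
    and star :: "'w \<Rightarrow> 'b \<Rightarrow> 'b \<Rightarrow> 'b"
    and p :: "'b \<Rightarrow> 'b"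
  assumes star_bilinear: "\<omega> \<in> Omega \<Longrightarrow> bilinear_op R A (star \<omega>)"
    and p_linear: "linear_endo R A p"
    and hom_prelie:
      "\<alpha> \<in> Omega \<Longrightarrow> \<beta> \<in> Omega \<Longrightarrow> x \<in> carrier A \<Longrightarrow> y \<in> carrier A \<Longrightarrow> z \<in> carrier A \<Longrightarrow>
        star \<alpha> (p x) (star \<beta> y z) \<ominus>\<^bsub>A\<^esub> star \<beta> (star \<alpha> x y) (p z) =
        star \<beta> (p y) (star \<alpha> x z) \<ominus>\<^bsub>A\<^esub> star \<alpha> (star \<beta> y x) (p z)"

end

theory Submission
  imports Defs
begin

text \<open>
  At weight zero, the Rota-Baxter identity splits the bracket of two images: with
  \<open>u = P \<alpha> x\<close> and \<open>v = P \<beta> y\<close>, it says \<open>\<lbrakk>u, v\<rbrakk> = P \<beta> \<lbrakk>u, y\<rbrakk> - P \<alpha> \<lbrakk>v, x\<rbrakk>\<close>, and the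
  brackets \<open>\<lbrakk>u, y\<rbrakk>\<close> and \<open>\<lbrakk>v, x\<rbrakk>\<close> are the new products \<open>x \<star>\<^sub>\<alpha> y\<close> and \<open>y \<star>\<^sub>\<beta> x\<close>
  (\<open>bracket_of_images\<close>). The Hom-Jacobi identity, rewritten by skew-symmetry, says
  \<open>\<lbrakk>p u, \<lbrakk>v, z\<rbrakk>\<rbrakk> - \<lbrakk>p v, \<lbrakk>u, z\<rbrakk>\<rbrakk> = \<lbrakk>\<lbrakk>u, v\<rbrakk>, p z\<rbrakk>\<close> (\<open>hom_leibniz\<close>).

  Substituting the first identity into the right-hand side of the second splits that side into
  \<open>(x \<star>\<^sub>\<alpha> y) \<star>\<^sub>\<beta> p z - (y \<star>\<^sub>\<beta> x) \<star>\<^sub>\<alpha> p z\<close>. On the left, \<open>p\<close> commutes with the operators, so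
  \<open>p u = P \<alpha> (p x)\<close> and \<open>p v = P \<beta> (p y)\<close>, and the two terms are \<open>p x \<star>\<^sub>\<alpha> (y \<star>\<^sub>\<beta> z)\<close> and
  \<open>p y \<star>\<^sub>\<beta> (x \<star>\<^sub>\<alpha> z)\<close>: this is the matching Hom-preLie identity.
\<close>

lemma linear_endo_closed:
  "linear_endo R A f \<Longrightarrow> x \<in> carrier A \<Longrightarrow> f x \<in> carrier A"
  by (auto simp: linear_endo_def)

lemma linear_endo_add:
  "linear_endo R A f \<Longrightarrow> x \<in> carrier A \<Longrightarrow> y \<in> carrier A \<Longrightarrow> f (x \<oplus>\<^bsub>A\<^esub> y) = f x \<oplus>\<^bsub>A\<^esub> f y"
  by (auto simp: linear_endo_def)

lemma linear_endo_comp: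
  assumes "linear_endo R A f" "linear_endo R A g"
  shows "linear_endo R A (\<lambda>x. f (g x))"
  using assms by (auto simp: linear_endo_def Pi_iff)

lemma (in module) linear_endo_neg:
  assumes f: "linear_endo R M f" and x: "x \<in> carrier M"
  shows "f (\<ominus>\<^bsub>M\<^esub> x) = \<ominus>\<^bsub>M\<^esub> f x"
proof -
  have scale: "f (c \<odot>\<^bsub>M\<^esub> y) = c \<odot>\<^bsub>M\<^esub> f y" if "c \<in> carrier R" "y \<in> carrier M" for c y
    using f that by (auto simp: linear_endo_def)
  have "f ((\<ominus> \<one>) \<odot>\<^bsub>M\<^esub> x) = (\<ominus> \<one>) \<odot>\<^bsub>M\<^esub> f x"
    using x by (intro scale) auto
  then show ?thesis
    using x linear_endo_closed[OF f x] by (simp add: smult_l_minus)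
qed

context hom_lie_algebra
begin

lemma bracket_linear_right: "x \<in> carrier A \<Longrightarrow> linear_endo R A (\<lambda>y. \<lbrakk>x, y\<rbrakk>)"
  using bracket_bilinear by (simp add: bilinear_op_def)

lemma bracket_linear_left: "y \<in> carrier A \<Longrightarrow> linear_endo R A (\<lambda>x. \<lbrakk>x, y\<rbrakk>)"
  using bracket_bilinear by (simp add: bilinear_op_def)

lemma bracket_closed [simp]: "x \<in> carrier A \<Longrightarrow> y \<in> carrier A \<Longrightarrow> \<lbrakk>x, y\<rbrakk> \<in> carrier A"
  using linear_endo_closed[OF bracket_linear_right] .

lemma p_closed [simp]: "x \<in> carrier A \<Longrightarrow> p x \<in> carrier A"
  using linear_endo_closed[OF p_linear] .

text \<open>Polarisation: expand \<open>\<lbrakk>x \<oplus> y, x \<oplus> y\<rbrakk>\<close>, whose diagonal terms vanish.\<close>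

lemma bracket_skew:
  assumes x: "x \<in> carrier A" and y: "y \<in> carrier A"
  shows "\<lbrakk>x, y\<rbrakk> = \<ominus>\<^bsub>A\<^esub> \<lbrakk>y, x\<rbrakk>"
proof -
  have "\<zero>\<^bsub>A\<^esub> = \<lbrakk>x \<oplus>\<^bsub>A\<^esub> y, x \<oplus>\<^bsub>A\<^esub> y\<rbrakk>"
    using x y by (simp add: bracket_self)
  also have "\<dots> = \<lbrakk>x, x \<oplus>\<^bsub>A\<^esub> y\<rbrakk> \<oplus>\<^bsub>A\<^esub> \<lbrakk>y, x \<oplus>\<^bsub>A\<^esub> y\<rbrakk>"
    using x y by (intro linear_endo_add[OF bracket_linear_left]) auto
  also have "\<dots> = (\<lbrakk>x, x\<rbrakk> \<oplus>\<^bsub>A\<^esub> \<lbrakk>x, y\<rbrakk>) \<oplus>\<^bsub>A\<^esub> (\<lbrakk>y, x\<rbrakk> \<oplus>\<^bsub>A\<^esub> \<lbrakk>y, y\<rbrakk>)"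
    using x y by (simp add: linear_endo_add[OF bracket_linear_right])
  also have "\<dots> = \<lbrakk>x, y\<rbrakk> \<oplus>\<^bsub>A\<^esub> \<lbrakk>y, x\<rbrakk>"
    using x y by (simp add: bracket_self)
  finally show ?thesis
    using x y by (simp add: M.minus_equality)
qed

text \<open>
  The Hom-Jacobi identity in Leibniz form: skew-symmetry brings each of its cyclic terms into the
  position where it can be compared with the iterated products of a Hom-preLie algebra.
\<close>

lemma hom_leibniz:
  assumes x: "x \<in> carrier A" and y: "y \<in> carrier A" and z: "z \<in> carrier A"
  shows "\<lbrakk>p x, \<lbrakk>y, z\<rbrakk>\<rbrakk> = \<lbrakk>p y, \<lbrakk>x, z\<rbrakk>\<rbrakk> \<oplus>\<^bsub>A\<^esub> \<lbrakk>\<lbrakk>x, y\<rbrakk>, p z\<rbrakk>"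
proof -
  have "\<lbrakk>p y, \<lbrakk>z, x\<rbrakk>\<rbrakk> = \<ominus>\<^bsub>A\<^esub> \<lbrakk>p y, \<lbrakk>x, z\<rbrakk>\<rbrakk>"
    using x y z by (simp add: bracket_skew[of z x] linear_endo_neg[OF bracket_linear_right])
  moreover have "\<lbrakk>p z, \<lbrakk>x, y\<rbrakk>\<rbrakk> = \<ominus>\<^bsub>A\<^esub> \<lbrakk>\<lbrakk>x, y\<rbrakk>, p z\<rbrakk>"
    using x y z by (intro bracket_skew) auto
  ultimately have "\<lbrakk>p x, \<lbrakk>y, z\<rbrakk>\<rbrakk> \<oplus>\<^bsub>A\<^esub> \<ominus>\<^bsub>A\<^esub> (\<lbrakk>p y, \<lbrakk>x, z\<rbrakk>\<rbrakk> \<oplus>\<^bsub>A\<^esub> \<lbrakk>\<lbrakk>x, y\<rbrakk>, p z\<rbrakk>) = \<zero>\<^bsub>A\<^esub>"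
    using hom_jacobi[OF x y z] x y z by (simp add: M.minus_add M.a_assoc)
  then have "\<ominus>\<^bsub>A\<^esub> (\<ominus>\<^bsub>A\<^esub> (\<lbrakk>p y, \<lbrakk>x, z\<rbrakk>\<rbrakk> \<oplus>\<^bsub>A\<^esub> \<lbrakk>\<lbrakk>x, y\<rbrakk>, p z\<rbrakk>)) = \<lbrakk>p x, \<lbrakk>y, z\<rbrakk>\<rbrakk>"
    using x y z by (intro M.minus_equality) auto
  then show ?thesis
    using x y z by simp
qed

end

context matching_hom_lie_rota_baxter_algebra
begin

lemma P_closed [simp]: "\<omega> \<in> Omega \<Longrightarrow> x \<in> carrier A \<Longrightarrow> P \<omega> x \<in> carrier A"
  using linear_endo_closed[OF P_linear] .

text \<open>
  The Rota-Baxter identity contains \<open>\<lbrakk>x, P \<beta> y\<rbrakk>\<close>, which has its operator on the wrong side to be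
  one of the products \<open>\<lbrakk>P \<omega> a, b\<rbrakk>\<close>. Skew-symmetry turns it into one, and the resulting sign makes
  the bracket of two images a difference of products under operators.
\<close>

lemma bracket_of_images:
  assumes w: "weight \<beta> = \<zero>"
    and \<alpha>: "\<alpha> \<in> Omega" and \<beta>: "\<beta> \<in> Omega" and x: "x \<in> carrier A" and y: "y \<in> carrier A"
  shows "\<lbrakk>P \<alpha> x, P \<beta> y\<rbrakk> = P \<beta> \<lbrakk>P \<alpha> x, y\<rbrakk> \<oplus>\<^bsub>A\<^esub> \<ominus>\<^bsub>A\<^esub> P \<alpha> \<lbrakk>P \<beta> y, x\<rbrakk>"
proof -
  have "P \<alpha> \<lbrakk>x, P \<beta> y\<rbrakk> = \<ominus>\<^bsub>A\<^esub> P \<alpha> \<lbrakk>P \<beta> y, x\<rbrakk>"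
    using \<alpha> \<beta> x y by (simp add: bracket_skew[of x] linear_endo_neg[OF P_linear])
  then show ?thesis
    using rota_baxter[OF \<alpha> \<beta> x y] \<alpha> \<beta> x y by (simp add: w M.a_comm)
qed

lemma bilinear_bracket_of_image:
  assumes "\<omega> \<in> Omega"
  shows "bilinear_op R A (\<lambda>x y. \<lbrakk>P \<omega> x, y\<rbrakk>)"
  unfolding bilinear_op_def
  using assms bracket_linear_right linear_endo_comp[OF bracket_linear_left P_linear] by simp

lemma hom_prelie_of_rota_baxter:
  assumes w: "weight \<beta> = \<zero>"
    and comm_\<alpha>: "p (P \<alpha> x) = P \<alpha> (p x)" and comm_\<beta>: "p (P \<beta> y) = P \<beta> (p y)"
    and \<alpha>: "\<alpha> \<in> Omega" and \<beta>: "\<beta> \<in> Omega"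
    and x: "x \<in> carrier A" and y: "y \<in> carrier A" and z: "z \<in> carrier A"
  shows "\<lbrakk>P \<alpha> (p x), \<lbrakk>P \<beta> y, z\<rbrakk>\<rbrakk> \<ominus>\<^bsub>A\<^esub> \<lbrakk>P \<beta> \<lbrakk>P \<alpha> x, y\<rbrakk>, p z\<rbrakk> =
         \<lbrakk>P \<beta> (p y), \<lbrakk>P \<alpha> x, z\<rbrakk>\<rbrakk> \<ominus>\<^bsub>A\<^esub> \<lbrakk>P \<alpha> \<lbrakk>P \<beta> y, x\<rbrakk>, p z\<rbrakk>"
proof -
  have split: "\<lbrakk>\<lbrakk>P \<alpha> x, P \<beta> y\<rbrakk>, p z\<rbrakk> =
      \<lbrakk>P \<beta> \<lbrakk>P \<alpha> x, y\<rbrakk>, p z\<rbrakk> \<oplus>\<^bsub>A\<^esub> \<ominus>\<^bsub>A\<^esub> \<lbrakk>P \<alpha> \<lbrakk>P \<beta> y, x\<rbrakk>, p z\<rbrakk>"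
    using \<alpha> \<beta> x y z
    by (simp add: bracket_of_images[OF w] linear_endo_add[OF bracket_linear_left]
        linear_endo_neg[OF bracket_linear_left])
  have "\<lbrakk>P \<alpha> (p x), \<lbrakk>P \<beta> y, z\<rbrakk>\<rbrakk> = \<lbrakk>P \<beta> (p y), \<lbrakk>P \<alpha> x, z\<rbrakk>\<rbrakk> \<oplus>\<^bsub>A\<^esub> \<lbrakk>\<lbrakk>P \<alpha> x, P \<beta> y\<rbrakk>, p z\<rbrakk>"
    using hom_leibniz[of "P \<alpha> x" "P \<beta> y" z] \<alpha> \<beta> x y z by (simp add: comm_\<alpha> comm_\<beta>)
  moreover have "b \<oplus>\<^bsub>A\<^esub> (c \<oplus>\<^bsub>A\<^esub> \<ominus>\<^bsub>A\<^esub> d) \<ominus>\<^bsub>A\<^esub> c = b \<ominus>\<^bsub>A\<^esub> d"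
    if "b \<in> carrier A" "c \<in> carrier A" "d \<in> carrier A" for b c d
    using that by (simp add: M.minus_eq M.a_assoc M.a_lcomm[of c] M.r_neg)
  ultimately show ?thesis
    using \<alpha> \<beta> x y z by (simp add: split)
qed

end

theorem proposition5p7:
  fixes R :: "('k, 'r) ring_scheme"
    and A :: "('k, 'a, 'm) module_scheme"
    and bracket :: "'a \<Rightarrow> 'a \<Rightarrow> 'a"
    and p :: "'a \<Rightarrow> 'a"
    and Omega :: "'w set"
    and weight :: "'w \<Rightarrow> 'k"
    and P :: "'w \<Rightarrow> 'a \<Rightarrow> 'a"
  assumes "Omega \<noteq> {}"
    and "matching_hom_lie_rota_baxter_algebra R A bracket p Omega weight P"
    and "\<And>\<omega>. \<omega> \<in> Omega \<Longrightarrow> weight \<omega> = \<zero>\<^bsub>R\<^esub>"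
    and "\<And>\<omega> x. \<omega> \<in> Omega \<Longrightarrow> x \<in> carrier A \<Longrightarrow> p (P \<omega> x) = P \<omega> (p x)"
  shows "matching_hom_prelie_algebra R A Omega (\<lambda>\<omega> x y. bracket (P \<omega> x) y) p"
proof -
  interpret matching_hom_lie_rota_baxter_algebra R A bracket p Omega weight P
    by (fact assms(2))
  show ?thesis
  proof unfold_locales
    show "bilinear_op R A (\<lambda>x y. bracket (P \<omega> x) y)" if "\<omega> \<in> Omega" for \<omega>
      using that by (rule bilinear_bracket_of_image)
    show "linear_endo R A p"
      by (fact p_linear)
  qed (rule hom_prelie_of_rota_baxter; simp add: assms(3,4))
qed

end
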